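(* Let $G$ be a finite simple graph that is $\{2K_2, K_2+P_4\}$-free and satisfies $\omega(G)\geq 4$. Then $\chi(G)\leq \omega(G)+2$.
   Context: $\chi(G)$ is the chromatic number and $\omega(G)$ the clique number of $G$. $2K_2$ is the disjoint union of two edges; $P_4$ is the path on four vertices. For graphs $G_1,G_2$, the join $G_1+G_2$ is their disjoint union together with all edges between $V(G_1)$ and $V(G_2)$; so $K_2+P_4$ is the graph on six vertices consisting of an edge and a $P_4$ with every vertex of the edge adjacent to every vertex of the $P_4$. A graph is $\mathcal{F}$-free if it has no induced subgraph isomorphic to a member of $\mathcal{F}$. *)

theory Defs
  imports "Graph_Theory.Graph_Theory"
begin

text \<open>
  An undirected simple graph is, as usual in this library, a symmetric loop-free digraph without
  parallel arcs: an edge \<open>uv\<close> is represented by the two arcs \<open>(u, v)\<close> and \<open>(v, u)\<close>. Finiteness of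
  the vertex set is part of the locale predicate \<^const>\<open>graph\<close>.
\<close>

definition proper_coloring :: "('a, 'b) pre_digraph \<Rightarrow> nat \<Rightarrow> ('a \<Rightarrow> nat) \<Rightarrow> bool" where
  "proper_coloring G k c \<longleftrightarrow>
     (\<forall>v \<in> verts G. c v < k) \<and>
     (\<forall>u \<in> verts G. \<forall>v \<in> verts G. u \<rightarrow>\<^bsub>G\<^esub> v \<longrightarrow> c u \<noteq> c v)"

definition chromatic_number :: "('a, 'b) pre_digraph \<Rightarrow> nat" where
  "chromatic_number G = (LEAST k. \<exists>c. proper_coloring G k c)"

definition clique_number :: "('a, 'b) pre_digraph \<Rightarrow> nat" where
  "clique_number G = Max {n. \<exists>H. subgraph H G \<and> K\<^bsub>n\<^esub> H}"

definition induced_free ::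
    "('c, 'd) pre_digraph set \<Rightarrow> ('a, 'b) pre_digraph \<Rightarrow> bool" where
  "induced_free \<F> G \<longleftrightarrow> \<not> (\<exists>F \<in> \<F>. \<exists>H. induced_subgraph H G \<and> digraph_iso H F)"

definition complete_graph :: "nat \<Rightarrow> nat pair_pre_digraph" where
  "complete_graph n =
     \<lparr> pverts = {..<n}, parcs = {(u, v). u < n \<and> v < n \<and> u \<noteq> v} \<rparr>"

definition path_graph :: "nat \<Rightarrow> nat pair_pre_digraph" where
  "path_graph n =
     \<lparr> pverts = {..<n}, parcs = {(u, v). u < n \<and> v < n \<and> (v = Suc u \<or> u = Suc v)} \<rparr>"

definition disjoint_union ::
    "'a pair_pre_digraph \<Rightarrow> 'b pair_pre_digraph \<Rightarrow> ('a + 'b) pair_pre_digraph" where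
  "disjoint_union G H =
     \<lparr> pverts = pverts G <+> pverts H,
       parcs = map_prod Inl Inl ` parcs G \<union> map_prod Inr Inr ` parcs H \<rparr>"

definition graph_join ::
    "'a pair_pre_digraph \<Rightarrow> 'b pair_pre_digraph \<Rightarrow> ('a + 'b) pair_pre_digraph" where
  "graph_join G H =
     \<lparr> pverts = pverts (disjoint_union G H),
       parcs = parcs (disjoint_union G H) \<union>
         (Inl ` pverts G) \<times> (Inr ` pverts H) \<union> (Inr ` pverts H) \<times> (Inl ` pverts G) \<rparr>"

definition two_K2 :: "(nat + nat) pair_pre_digraph" where
  "two_K2 = disjoint_union (complete_graph 2) (complete_graph 2)"

definition K2_join_P4 :: "(nat + nat) pair_pre_digraph" where
  "K2_join_P4 = graph_join (complete_graph 2) (path_graph 4)"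

end

theory Submission
  imports Defs
begin

text \<open>
  Fix a maximum clique \<open>K\<close> and, for a vertex \<open>x\<close>, let \<open>M x\<close> be the set of vertices of \<open>K\<close> not
  adjacent to \<open>x\<close>. If \<open>x\<close> and \<open>y\<close> are adjacent, then \<open>M x\<close> and \<open>M y\<close> share at most one vertex, because
  two common vertices would give a \<open>2K\<^sub>2\<close>; and if two vertices of \<open>K\<close> lie outside \<open>M x \<union> M y\<close>, then
  \<open>M x\<close> and \<open>M y\<close> are disjoint, because a common vertex would give a larger clique or a \<open>P\<^sub>4\<close> joined
  to an edge. Choose four vertices \<open>a, b, c, d\<close> of \<open>K\<close>. The \<open>x\<close> with \<open>{a, b} \<subseteq> M x\<close> form one colour
  class and those with \<open>{c, d} \<subseteq> M x\<close> a second one. For any other \<open>x\<close>, the trace of \<open>M x\<close> on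
  \<open>{a, b, c, d}\<close> is empty, a singleton or one of \<open>ac, bd, bc, ad\<close>. Grouping the nonempty traces as
  \<open>a, ac | b, bd | c, bc | d, ad\<close>, the members of a group share a vertex \<open>k\<close> and avoid a common pair
  \<open>P k\<close>, so each group is a colour class. If the trace is empty, \<open>M x\<close> avoids \<open>{a, b}\<close> and any
  \<open>k \<in> M x\<close> serves as the colour of \<open>x\<close>.
\<close>

unbundle no funcset_syntax

lemma arcs_ends_induce_subgraph: "arcs_ends (G \<restriction> S) = arcs_ends G \<inter> S \<times> S"
  by (auto simp: arcs_ends_conv)

lemma (in nomulti_digraph) bij_betw_arc_to_ends:
  "bij_betw (arc_to_ends G) (arcs G) (arcs_ends G)"
  by (simp add: bij_betw_def inj_on_arc_to_ends arcs_ends_def)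

lemma (in wf_digraph) inj_on_map_prod_arcs_ends:
  assumes "inj_on h (verts G)"
  shows "inj_on (map_prod h h) (arcs_ends G)"
proof (rule inj_on_subset)
  show "inj_on (map_prod h h) (verts G \<times> verts G)"
    using assms by (intro map_prod_inj_on)
  show "arcs_ends G \<subseteq> verts G \<times> verts G"
    by (auto simp: arcs_ends_conv)
qed

lemma nomulti_digraph_isoI:
  assumes "nomulti_digraph G" "nomulti_digraph H"
    and verts: "bij_betw h (verts G) (verts H)"
    and ends: "map_prod h h ` arcs_ends G = arcs_ends H"
  shows "digraph_iso G H"
proof -
  interpret G: nomulti_digraph G by fact
  interpret H: nomulti_digraph H by fact
  define arc_map where
    "arc_map = the_inv_into (arcs H) (arc_to_ends H) \<circ> (map_prod h h \<circ> arc_to_ends G)"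
  define iso where
    "iso = \<lparr>iso_verts = h, iso_arcs = arc_map, iso_head = head H, iso_tail = tail H\<rparr>"
  have "bij_betw (map_prod h h) (arcs_ends G) (arcs_ends H)"
    using verts ends G.inj_on_map_prod_arcs_ends by (auto simp: bij_betw_def)
  with G.bij_betw_arc_to_ends have ends_bij:
    "bij_betw (map_prod h h \<circ> arc_to_ends G) (arcs G) (arcs_ends H)"
    by (rule bij_betw_trans)
  then have arcs: "bij_betw arc_map (arcs G) (arcs H)"
    unfolding arc_map_def
    by (rule bij_betw_trans) (intro bij_betw_the_inv_into H.bij_betw_arc_to_ends)
  have "arc_to_ends H (arc_map a) = map_prod h h (arc_to_ends G a)" if "a \<in> arcs G" for a
    using f_the_inv_into_f_bij_betw[OF H.bij_betw_arc_to_ends] bij_betwE[OF ends_bij] that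
    by (simp add: arc_map_def)
  then have "G.digraph_isomorphism iso"
    using verts arcs G.wf_digraph
    by (auto simp: G.digraph_isomorphism_def iso_def bij_betw_def arc_to_ends_def)
  moreover have "H = app_iso iso G"
    using verts arcs by (intro pre_digraph.equality) (auto simp: iso_def bij_betw_def)
  ultimately show ?thesis
    by (auto simp: digraph_iso_def)
qed

lemma sum_pair_cases:
  obtains (Inl_Inl) u v where "e = (Inl u, Inl v)" | (Inl_Inr) u v where "e = (Inl u, Inr v)"
  | (Inr_Inl) u v where "e = (Inr u, Inl v)" | (Inr_Inr) u v where "e = (Inr u, Inr v)"
  by (metis prod.exhaust sum.exhaust)

lemma inj_on_case_sum:
  assumes "inj_on f A" "inj_on g B" "f ` A \<inter> g ` B = {}"
  shows "inj_on (case_sum f g) (A <+> B)"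
proof (rule inj_onI)
  fix s t assume "s \<in> A <+> B" "t \<in> A <+> B" "case_sum f g s = case_sum f g t"
  with assms show "s = t"
    by (cases s; cases t) (auto dest: inj_onD)
qed

lemma pverts_disjoint_union [simp]: "pverts (disjoint_union F F') = pverts F <+> pverts F'"
  by (simp add: disjoint_union_def)

lemma parcs_disjoint_union_iff [simp]:
  "(Inl u, Inl v) \<in> parcs (disjoint_union F F') \<longleftrightarrow> (u, v) \<in> parcs F"
  "(Inl u, Inr v') \<notin> parcs (disjoint_union F F')"
  "(Inr u', Inl v) \<notin> parcs (disjoint_union F F')"
  "(Inr u', Inr v') \<in> parcs (disjoint_union F F') \<longleftrightarrow> (u', v') \<in> parcs F'"
  by (auto simp: disjoint_union_def)

lemma pverts_graph_join [simp]: "pverts (graph_join F F') = pverts F <+> pverts F'"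
  by (simp add: graph_join_def)

lemma parcs_graph_join_iff [simp]:
  "(Inl u, Inl v) \<in> parcs (graph_join F F') \<longleftrightarrow> (u, v) \<in> parcs F"
  "(Inl u, Inr v') \<in> parcs (graph_join F F') \<longleftrightarrow> u \<in> pverts F \<and> v' \<in> pverts F'"
  "(Inr u', Inl v) \<in> parcs (graph_join F F') \<longleftrightarrow> u' \<in> pverts F' \<and> v \<in> pverts F"
  "(Inr u', Inr v') \<in> parcs (graph_join F F') \<longleftrightarrow> (u', v') \<in> parcs F'"
  by (simp_all add: graph_join_def image_iff)

lemma induced_free_insert:
  "induced_free (insert F \<F>) G \<longleftrightarrow> induced_free {F} G \<and> induced_free \<F> G"
  by (auto simp: induced_free_def)

definition induced_embedding ::
    "'c pair_pre_digraph \<Rightarrow> ('c \<Rightarrow> 'a) \<Rightarrow> ('a, 'b) pre_digraph \<Rightarrow> bool" where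
  "induced_embedding F g G \<longleftrightarrow>
     inj_on g (pverts F) \<and> g ` pverts F \<subseteq> verts G \<and>
     parcs F = {(u, v) \<in> pverts F \<times> pverts F. g u \<rightarrow>\<^bsub>G\<^esub> g v}"

lemma (in nomulti_digraph) induced_embedding_imp_not_induced_free:
  assumes "induced_embedding F g G"
  shows "\<not> induced_free {with_proj F} G"
proof -
  define H where "H = G \<restriction> (g ` pverts F)"
  have parcs: "parcs F = {(u, v) \<in> pverts F \<times> pverts F. g u \<rightarrow> g v}"
    using assms by (simp add: induced_embedding_def)
  have ind: "induced_subgraph H G"
    using assms unfolding H_def by (intro induced_induce) (simp add: induced_embedding_def)
  have F: "nomulti_digraph (with_proj F)"
    by unfold_locales (auto simp: parcs arc_to_ends_def)
  moreover have "nomulti_digraph H"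
    unfolding H_def nomulti_digraph_def nomulti_digraph_axioms_def
    using no_multi_arcs by auto
  moreover have "bij_betw g (verts (with_proj F)) (verts H)"
    using assms by (auto simp: induced_embedding_def bij_betw_def H_def)
  moreover have "map_prod g g ` arcs_ends (with_proj F) = arcs_ends H"
    by (auto simp: parcs H_def arcs_ends_induce_subgraph)
  ultimately have "digraph_iso (with_proj F) H"
    by (rule nomulti_digraph_isoI)
  then have "digraph_iso H (with_proj F)"
    by (rule digraph_iso_swap[OF nomulti_digraph.axioms(1)[OF F]])
  with ind show ?thesis
    by (auto simp: induced_free_def)
qed

context pre_digraph
begin

definition clique :: "'a set \<Rightarrow> bool" where
  "clique S \<longleftrightarrow> S \<subseteq> verts G \<and> pairwise (\<lambda>u v. u \<rightarrow> v) S"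

definition independent_set :: "'a set \<Rightarrow> bool" where
  "independent_set S \<longleftrightarrow> S \<subseteq> verts G \<and> (\<forall>u \<in> S. \<forall>v \<in> S. \<not> u \<rightarrow> v)"

definition complete_to :: "'a set \<Rightarrow> 'a set" where
  "complete_to S = {x \<in> verts G. \<forall>v \<in> S. x \<rightarrow> v}"

definition anticomplete_to :: "'a set \<Rightarrow> 'a set" where
  "anticomplete_to S = {x \<in> verts G. \<forall>v \<in> S. \<not> x \<rightarrow> v}"

lemma cliqueD: "\<lbrakk>clique S; u \<in> S; v \<in> S; u \<noteq> v\<rbrakk> \<Longrightarrow> u \<rightarrow> v"
  by (simp add: clique_def pairwise_def)

lemma chromatic_number_le_card_independent_cover:
  assumes "finite \<I>"
    and indep: "\<And>S. S \<in> \<I> \<Longrightarrow> independent_set S"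
    and cover: "verts G \<subseteq> \<Union>\<I>"
  shows "chromatic_number G \<le> card \<I>"
proof -
  obtain num where num: "bij_betw num \<I> {0..<card \<I>}"
    using ex_bij_betw_finite_nat[OF \<open>finite \<I>\<close>] by blast
  have "\<forall>v \<in> verts G. \<exists>S. S \<in> \<I> \<and> v \<in> S"
    using cover by blast
  then obtain cls where cls: "\<And>v. v \<in> verts G \<Longrightarrow> cls v \<in> \<I> \<and> v \<in> cls v"
    by metis
  have "proper_coloring G (card \<I>) (num \<circ> cls)"
    unfolding proper_coloring_def
  proof (intro conjI ballI impI)
    show "(num \<circ> cls) v < card \<I>" if "v \<in> verts G" for v
      using that cls bij_betwE[OF num] by auto
    show "(num \<circ> cls) u \<noteq> (num \<circ> cls) v" if "u \<in> verts G" "v \<in> verts G" "u \<rightarrow> v" for u v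
    proof
      assume "(num \<circ> cls) u = (num \<circ> cls) v"
      then have "cls u = cls v"
        using that cls num by (auto simp: bij_betw_def dest: inj_onD)
      then show False
        using that cls[of u] cls[of v] indep[of "cls u"] by (auto simp: independent_set_def)
    qed
  qed
  then show ?thesis
    unfolding chromatic_number_def by (intro Least_le) blast
qed

end

context graph
begin

lemma not_self_adj [simp]: "\<not> u \<rightarrow> u"
  using adj_not_same by blast

lemma adj_commute: "u \<rightarrow> v \<longleftrightarrow> v \<rightarrow> u"
  using graph_symmetric by blast

lemma complete_to_imp_notin: "x \<in> complete_to S \<Longrightarrow> x \<notin> S"
  by (auto simp: complete_to_def)

lemma clique_insert_iff: "clique (insert x S) \<longleftrightarrow> clique S \<and> x \<in> complete_to (S - {x})"
  by (auto simp: clique_def complete_to_def pairwise_insert adj_commute)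

lemma clique_verts_complete_subgraph:
  assumes "subgraph H G" "K\<^bsub>n\<^esub> H"
  shows "clique (verts H)"
  using assms adj_mono[of _ _ H]
  by (auto simp: clique_def pairwise_def complete_digraph_def dest: subgraph_imp_subverts)

lemma complete_digraph_induce_clique:
  assumes "clique S"
  shows "K\<^bsub>card S\<^esub> (G \<restriction> S)"
proof -
  have "induced_subgraph (G \<restriction> S) G"
    using assms by (intro induced_induce) (simp add: clique_def)
  then have "graph (G \<restriction> S)"
    by (intro digraph.graphI digraphI_induced induced_graph_imp_symmetric[OF sym_arcs])
  moreover have "arcs_ends (G \<restriction> S) = {(u, v). (u, v) \<in> S \<times> S \<and> u \<noteq> v}"
    using cliqueD[OF assms] by (auto simp: arcs_ends_induce_subgraph)
  ultimately show ?thesis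
    by (simp add: complete_digraph_def)
qed

lemma clique_number_eq_Max_card: "clique_number G = Max (card ` {S. clique S})"
proof -
  have "(\<exists>H. subgraph H G \<and> K\<^bsub>n\<^esub> H) \<longleftrightarrow> n \<in> card ` {S. clique S}" for n
  proof
    assume "\<exists>H. subgraph H G \<and> K\<^bsub>n\<^esub> H"
    then obtain H where H: "subgraph H G" "K\<^bsub>n\<^esub> H" by blast
    then have "n = card (verts H)"
      by (simp add: complete_digraph_def)
    with clique_verts_complete_subgraph[OF H] show "n \<in> card ` {S. clique S}"
      by blast
  next
    assume "n \<in> card ` {S. clique S}"
    then obtain S where S: "clique S" "n = card S" by blast
    then have "induced_subgraph (G \<restriction> S) G"
      by (intro induced_induce) (simp add: clique_def)
    with S show "\<exists>H. subgraph H G \<and> K\<^bsub>n\<^esub> H"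
      by (blast intro: complete_digraph_induce_clique induced_imp_subgraph)
  qed
  then show ?thesis
    by (simp add: clique_number_def)
qed

lemma finite_cliques: "finite {S. clique S}"
  by (rule finite_subset[of _ "Pow (verts G)"]) (auto simp: clique_def)

lemma finite_clique: "clique S \<Longrightarrow> finite S"
  by (auto simp: clique_def intro: finite_subset)

lemma card_clique_le_clique_number: "clique S \<Longrightarrow> card S \<le> clique_number G"
  by (simp add: clique_number_eq_Max_card finite_cliques)

lemma obtain_maximum_clique:
  obtains S where "clique S" "card S = clique_number G"
proof -
  have "clique {}"
    by (simp add: clique_def)
  then have "clique_number G \<in> card ` {S. clique S}"
    unfolding clique_number_eq_Max_card by (intro Max_in) (auto simp: finite_cliques)
  with that show thesis by auto
qed

lemma complete_to_maximum_clique_eq_empty: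
  assumes "clique S" "card S = clique_number G"
  shows "complete_to S = {}"
proof (rule ccontr)
  assume "complete_to S \<noteq> {}"
  then obtain x where x: "x \<in> complete_to S" by blast
  then have "clique (insert x S)"
    using assms(1) complete_to_imp_notin by (simp add: clique_insert_iff)
  moreover have "card (insert x S) = Suc (card S)"
    using x assms(1) by (simp add: complete_to_imp_notin finite_clique)
  ultimately show False
    using assms(2) card_clique_le_clique_number by fastforce
qed

lemma independent_set_complete_to_maximum_clique_minus:
  assumes K: "clique K" "card K = clique_number G" and i: "i \<in> K"
  shows "independent_set (complete_to (K - {i}))"
proof -
  have "\<not> x \<rightarrow> y" if x: "x \<in> complete_to (K - {i})" and y: "y \<in> complete_to (K - {i})" for x y
  proof
    assume "x \<rightarrow> y"
    have x_notin: "x \<notin> K - {i}"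
      using x by (rule complete_to_imp_notin)
    have "clique (K - {i})"
      using K(1) clique_insert_iff[of i "K - {i}"] i by (simp add: insert_absorb)
    then have "clique (insert x (K - {i}))"
      using x x_notin by (simp add: clique_insert_iff)
    moreover have "card (insert x (K - {i})) = clique_number G"
      using card.insert[OF _ x_notin] card_Suc_Diff1[OF _ i] finite_clique[OF K(1)] K(2) by simp
    ultimately have "complete_to (insert x (K - {i})) = {}"
      by (rule complete_to_maximum_clique_eq_empty)
    moreover have "y \<in> complete_to (insert x (K - {i}))"
      using y \<open>x \<rightarrow> y\<close> by (auto simp: complete_to_def adj_commute)
    ultimately show False by blast
  qed
  then show ?thesis
    by (auto simp: independent_set_def complete_to_def)
qed

lemma induced_embedding_complete_graph:
  assumes "distinct xs" "clique (set xs)"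
  shows "induced_embedding (complete_graph (length xs)) ((!) xs) G"
proof -
  have "xs ! i \<rightarrow> xs ! j \<longleftrightarrow> i \<noteq> j" if "i < length xs" "j < length xs" for i j
    using that assms cliqueD[of "set xs" "xs ! i" "xs ! j"] by (auto simp: nth_eq_iff_index_eq)
  moreover have "set xs \<subseteq> verts G"
    using assms(2) by (simp add: clique_def)
  ultimately show ?thesis
    using assms(1)
    by (auto simp: induced_embedding_def complete_graph_def inj_on_def nth_eq_iff_index_eq)
qed

lemma induced_embedding_edge:
  assumes "a \<rightarrow> b"
  shows "induced_embedding (complete_graph 2) ((!) [a, b]) G"
proof -
  have "distinct [a, b]" "clique (set [a, b])"
    using assms by (auto simp: clique_def pairwise_insert adj_commute dest: adj_in_verts)
  from induced_embedding_complete_graph[OF this] show ?thesis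
    by (simp add: numeral_2_eq_2)
qed

lemma induced_embedding_path_graph:
  assumes "distinct xs" "set xs \<subseteq> verts G"
    and adj: "\<And>i j. \<lbrakk>i < j; j < length xs\<rbrakk> \<Longrightarrow> xs ! i \<rightarrow> xs ! j \<longleftrightarrow> j = Suc i"
  shows "induced_embedding (path_graph (length xs)) ((!) xs) G"
proof -
  have "xs ! i \<rightarrow> xs ! j \<longleftrightarrow> j = Suc i \<or> i = Suc j" if "i < length xs" "j < length xs" for i j
    using that adj[of i j] adj[of j i]
    by (cases i j rule: linorder_cases) (auto simp: adj_commute)
  then show ?thesis
    using assms(1,2)
    by (auto simp: induced_embedding_def path_graph_def inj_on_def nth_eq_iff_index_eq)
qed

lemma induced_embedding_disjoint_union:
  assumes g: "induced_embedding F g G" and g': "induced_embedding F' g' G"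
    and disjoint: "g ` pverts F \<inter> g' ` pverts F' = {}"
    and non_adj: "\<And>u v. \<lbrakk>u \<in> pverts F; v \<in> pverts F'\<rbrakk> \<Longrightarrow> \<not> g u \<rightarrow> g' v"
  shows "induced_embedding (disjoint_union F F') (case_sum g g') G"
  unfolding induced_embedding_def
proof (intro conjI set_eqI)
  let ?H = "disjoint_union F F'"
  show "inj_on (case_sum g g') (pverts ?H)"
    using g g' disjoint by (simp add: induced_embedding_def inj_on_case_sum)
  show "case_sum g g' ` pverts ?H \<subseteq> verts G"
    using g g' by (auto simp: induced_embedding_def)
  have "\<not> g' v \<rightarrow> g u" if "u \<in> pverts F" "v \<in> pverts F'" for u v
    using non_adj[OF that] by (simp add: adj_commute)
  with non_adj show "e \<in> parcs ?H \<longleftrightarrow> e \<in>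
      {(u, v) \<in> pverts ?H \<times> pverts ?H. case_sum g g' u \<rightarrow> case_sum g g' v}" for e
    using g g' by (cases e rule: sum_pair_cases) (auto simp: induced_embedding_def)
qed

lemma induced_embedding_graph_join:
  assumes g: "induced_embedding F g G" and g': "induced_embedding F' g' G"
    and adj: "\<And>u v. \<lbrakk>u \<in> pverts F; v \<in> pverts F'\<rbrakk> \<Longrightarrow> g u \<rightarrow> g' v"
  shows "induced_embedding (graph_join F F') (case_sum g g') G"
  unfolding induced_embedding_def
proof (intro conjI set_eqI)
  let ?H = "graph_join F F'"
  have "g ` pverts F \<inter> g' ` pverts F' = {}"
    using adj not_self_adj by fastforce
  then show "inj_on (case_sum g g') (pverts ?H)"
    using g g' by (simp add: induced_embedding_def inj_on_case_sum)
  show "case_sum g g' ` pverts ?H \<subseteq> verts G"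
    using g g' by (auto simp: induced_embedding_def)
  have "g' v \<rightarrow> g u" if "u \<in> pverts F" "v \<in> pverts F'" for u v
    using adj[OF that] by (simp add: adj_commute)
  with adj show "e \<in> parcs ?H \<longleftrightarrow> e \<in>
      {(u, v) \<in> pverts ?H \<times> pverts ?H. case_sum g g' u \<rightarrow> case_sum g g' v}" for e
    using g g' by (cases e rule: sum_pair_cases) (auto simp: induced_embedding_def)
qed

lemma two_K2_free_edges_adjacent:
  assumes free: "induced_free {with_proj two_K2} G"
    and "a \<rightarrow> b" "c \<rightarrow> d"
  shows "a \<rightarrow> c \<or> a \<rightarrow> d \<or> b \<rightarrow> c \<or> b \<rightarrow> d"
proof (rule ccontr)
  assume no_edge: "\<not> (a \<rightarrow> c \<or> a \<rightarrow> d \<or> b \<rightarrow> c \<or> b \<rightarrow> d)"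
  have "{a, b} \<inter> {c, d} = {}"
    using no_edge assms(2,3) by (auto simp: adj_commute)
  with no_edge have "induced_embedding two_K2 (case_sum ((!) [a, b]) ((!) [c, d])) G"
    unfolding two_K2_def
    using induced_embedding_edge[OF assms(2)] induced_embedding_edge[OF assms(3)]
    by (intro induced_embedding_disjoint_union) (auto simp: complete_graph_def less_2_cases_iff)
  with free show False
    using induced_embedding_imp_not_induced_free by blast
qed

lemma K2_join_P4_free_path_chord:
  assumes free: "induced_free {with_proj K2_join_P4} G"
    and "p \<rightarrow> q" and "{p, q} \<subseteq> complete_to {a, b, c, d}"
    and path: "a \<rightarrow> b" "b \<rightarrow> c" "c \<rightarrow> d"
  shows "a \<rightarrow> c \<or> a \<rightarrow> d \<or> b \<rightarrow> d"
proof (rule ccontr)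
  assume no_edge: "\<not> (a \<rightarrow> c \<or> a \<rightarrow> d \<or> b \<rightarrow> d)"
  have distinct: "distinct [a, b, c, d]"
    using path no_edge by (auto simp: adj_commute)
  have "induced_embedding (path_graph (length [a, b, c, d])) ((!) [a, b, c, d]) G"
  proof (rule induced_embedding_path_graph[OF distinct])
    show "set [a, b, c, d] \<subseteq> verts G"
      using path by (auto dest: adj_in_verts)
    show "[a, b, c, d] ! i \<rightarrow> [a, b, c, d] ! j \<longleftrightarrow> j = Suc i"
      if "i < j" "j < length [a, b, c, d]" for i j
      using that path no_edge by (auto simp: less_Suc_eq numeral_eq_Suc)
  qed
  then have "induced_embedding K2_join_P4 (case_sum ((!) [p, q]) ((!) [a, b, c, d])) G"
    unfolding K2_join_P4_def
    using induced_embedding_edge[OF assms(2)] assms(3)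
    by (intro induced_embedding_graph_join)
      (auto simp: complete_graph_def path_graph_def complete_to_def less_Suc_eq numeral_eq_Suc)
  with free show False
    using induced_embedding_imp_not_induced_free by blast
qed

lemma independent_set_anticomplete_to_edge:
  assumes "induced_free {with_proj two_K2} G" "a \<rightarrow> b"
  shows "independent_set (anticomplete_to {a, b})"
  using two_K2_free_edges_adjacent[OF assms(1) _ assms(2)]
  by (auto simp: independent_set_def anticomplete_to_def)

lemma adjacent_imp_complete_to_clique_minus:
  assumes free: "induced_free {with_proj two_K2} G" "induced_free {with_proj K2_join_P4} G"
    and K: "clique K" "{p, q, i} \<subseteq> K" "p \<noteq> q"
    and xy: "x \<rightarrow> y" "{x, y} \<subseteq> complete_to {p, q} \<inter> anticomplete_to {i}"
  shows "x \<in> complete_to (K - {i})"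
proof -
  have x_pq: "x \<rightarrow> p" "x \<rightarrow> q" and y_pq: "y \<rightarrow> p" "y \<rightarrow> q"
    and not_i: "\<not> x \<rightarrow> i" "\<not> y \<rightarrow> i"
    using xy(2) by (auto simp: complete_to_def anticomplete_to_def)
  have "x \<rightarrow> j" if j: "j \<in> K" "j \<noteq> i" for j
  proof (rule ccontr)
    assume not_xj: "\<not> x \<rightarrow> j"
    have ji: "j \<rightarrow> i" and pq: "p \<rightarrow> q"
      using j K by (auto intro: cliqueD[OF K(1)])
    have yj: "y \<rightarrow> j"
      using two_K2_free_edges_adjacent[OF free(1) xy(1) ji] not_i not_xj by blast
    have "{p, q} \<subseteq> complete_to {x, y, j, i}"
    proof -
      have "{p, q} \<inter> {i, j} = {}"
        using x_pq not_xj not_i by auto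
      then have "p \<rightarrow> j" "p \<rightarrow> i" "q \<rightarrow> j" "q \<rightarrow> i"
        using j K(2) by (auto intro!: cliqueD[OF K(1)])
      with x_pq y_pq pq show ?thesis
        by (auto simp: complete_to_def adj_commute dest: adj_in_verts)
    qed
    then show False
      using K2_join_P4_free_path_chord[OF free(2) pq _ xy(1) yj ji] not_i not_xj by blast
  qed
  with xy(2) show ?thesis
    by (auto simp: complete_to_def)
qed

lemma independent_set_complete_to_pair_anticomplete_to:
  assumes free: "induced_free {with_proj two_K2} G" "induced_free {with_proj K2_join_P4} G"
    and K: "clique K" "card K = clique_number G" "i \<in> K"
    and P: "P \<subseteq> K" "card P = 2"
  shows "independent_set (complete_to P \<inter> anticomplete_to {i})"
proof -
  obtain p q where pq: "P = {p, q}" "p \<noteq> q"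
    using P(2) by (auto simp: card_2_iff)
  then have K_pqi: "{p, q, i} \<subseteq> K"
    using P(1) K(3) by simp
  have False
    if xy: "x \<in> complete_to P \<inter> anticomplete_to {i}" "y \<in> complete_to P \<inter> anticomplete_to {i}"
      and "x \<rightarrow> y" for x y
  proof -
    have "x \<in> complete_to (K - {i})" "y \<in> complete_to (K - {i})"
      using adjacent_imp_complete_to_clique_minus[OF free K(1) K_pqi pq(2), of x y]
        adjacent_imp_complete_to_clique_minus[OF free K(1) K_pqi pq(2), of y x]
        xy \<open>x \<rightarrow> y\<close> pq(1) by (simp_all add: adj_commute)
    with \<open>x \<rightarrow> y\<close> show False
      using independent_set_complete_to_maximum_clique_minus[OF K]
      by (simp add: independent_set_def)
  qed
  then show ?thesis
    by (auto simp: independent_set_def complete_to_def)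
qed

end

lemma avoiding_pairs_of_four:
  assumes "distinct [a, b, c, d]"
  obtains P where "\<And>k. P k \<subseteq> {a, b, c, d}" "\<And>k. card (P k) = 2"
    "\<And>T. \<lbrakk>T \<noteq> {}; \<not> {a, b} \<subseteq> T; \<not> {c, d} \<subseteq> T\<rbrakk> \<Longrightarrow> \<exists>k \<in> T. P k \<inter> T = {}"
proof
  define P where
    "P k = (if k = a then {b, d} else if k = b then {a, c}
            else if k = c then {a, d} else if k = d then {b, c} else {a, b})" for k
  show "P k \<subseteq> {a, b, c, d}" "card (P k) = 2" for k
    using assms by (auto simp: P_def)
  show "\<exists>k \<in> T. P k \<inter> T = {}"
    if T: "T \<noteq> {}" "\<not> {a, b} \<subseteq> T" "\<not> {c, d} \<subseteq> T" for T
  proof -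
    have avoids: "P a \<inter> T = {} \<longleftrightarrow> b \<notin> T \<and> d \<notin> T" "P b \<inter> T = {} \<longleftrightarrow> a \<notin> T \<and> c \<notin> T"
      "P c \<inter> T = {} \<longleftrightarrow> a \<notin> T \<and> d \<notin> T" "P d \<inter> T = {} \<longleftrightarrow> b \<notin> T \<and> c \<notin> T"
      "\<And>k. k \<notin> {a, b, c, d} \<Longrightarrow> P k \<inter> T = {} \<longleftrightarrow> a \<notin> T \<and> b \<notin> T"
      using assms by (auto simp: P_def)
    consider "a \<in> T" "b \<notin> T" "d \<notin> T" | "b \<in> T" "a \<notin> T" "c \<notin> T"
      | "c \<in> T" "a \<notin> T" "d \<notin> T" | "d \<in> T" "b \<notin> T" "c \<notin> T"
      | k where "k \<in> T" "k \<notin> {a, b, c, d}" "a \<notin> T" "b \<notin> T"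
      using T by auto
    then show ?thesis
      by cases (use avoids in blast)+
  qed
qed

lemma obtain_four_elements:
  assumes "card K \<ge> 4"
  obtains a b c d where "distinct [a, b, c, d]" "{a, b, c, d} \<subseteq> K"
proof -
  obtain L where L: "L \<subseteq> K" "card L = 4" "finite L"
    using obtain_subset_with_card_n[OF assms] by blast
  then obtain xs where xs: "set xs = L" "distinct xs"
    using finite_distinct_list by blast
  then have "length xs = 4"
    using L by (simp flip: distinct_card)
  then obtain a b c d where "xs = [a, b, c, d]"
    by (auto simp: numeral_eq_Suc length_Suc_conv)
  with that xs L(1) show thesis by auto
qed

context graph
begin

lemma verts_subset_avoiding_pairs_cover:
  assumes K: "clique K" "card K = clique_number G" and abcd: "{a, b, c, d} \<subseteq> K"
    and P: "\<And>k. P k \<subseteq> {a, b, c, d}"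
    and avoid: "\<And>T. \<lbrakk>T \<noteq> {}; \<not> {a, b} \<subseteq> T; \<not> {c, d} \<subseteq> T\<rbrakk> \<Longrightarrow> \<exists>k \<in> T. P k \<inter> T = {}"
  shows "verts G \<subseteq> anticomplete_to {a, b} \<union> anticomplete_to {c, d} \<union>
    (\<Union>k \<in> K. complete_to (P k) \<inter> anticomplete_to {k})"
proof
  fix x assume x: "x \<in> verts G"
  define T where "T = {k \<in> K. \<not> x \<rightarrow> k}"
  have "T \<noteq> {}"
    using complete_to_maximum_clique_eq_empty[OF K] x by (auto simp: T_def complete_to_def)
  then consider "{a, b} \<subseteq> T" | "{c, d} \<subseteq> T" | k where "k \<in> T" "P k \<inter> T = {}"
    using avoid[of T] by blast
  then show "x \<in> anticomplete_to {a, b} \<union> anticomplete_to {c, d} \<union>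
    (\<Union>k \<in> K. complete_to (P k) \<inter> anticomplete_to {k})"
  proof cases
    case (3 k)
    have "x \<rightarrow> v" if "v \<in> P k" for v
      using that P[of k] abcd 3(2) by (auto simp: T_def)
    with 3(1) x show ?thesis
      by (auto simp: T_def complete_to_def anticomplete_to_def)
  qed (use x in \<open>simp_all add: T_def anticomplete_to_def\<close>)
qed

lemma obtain_independent_cover:
  assumes free: "induced_free {with_proj two_K2} G" "induced_free {with_proj K2_join_P4} G"
    and "clique_number G \<ge> 4"
  obtains \<I> where "finite \<I>" "\<And>S. S \<in> \<I> \<Longrightarrow> independent_set S" "verts G \<subseteq> \<Union>\<I>"
    "card \<I> \<le> clique_number G + 2"
proof -
  obtain K where K: "clique K" "card K = clique_number G"
    by (rule obtain_maximum_clique)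
  then obtain a b c d where abcd: "distinct [a, b, c, d]" "{a, b, c, d} \<subseteq> K"
    using assms(3) by (metis obtain_four_elements)
  obtain P where P: "\<And>k. P k \<subseteq> {a, b, c, d}" "\<And>k. card (P k) = 2"
    and avoid: "\<And>T. \<lbrakk>T \<noteq> {}; \<not> {a, b} \<subseteq> T; \<not> {c, d} \<subseteq> T\<rbrakk> \<Longrightarrow> \<exists>k \<in> T. P k \<inter> T = {}"
    using avoiding_pairs_of_four[OF abcd(1)] by blast
  define cls where "cls k = complete_to (P k) \<inter> anticomplete_to {k}" for k
  define \<I> where "\<I> = {anticomplete_to {a, b}, anticomplete_to {c, d}} \<union> cls ` K"
  have "a \<rightarrow> b" "c \<rightarrow> d"
    using abcd by (auto intro: cliqueD[OF K(1)])
  moreover have "independent_set (cls k)" if "k \<in> K" for k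
    unfolding cls_def using P(1)[of k] abcd(2)
    by (intro independent_set_complete_to_pair_anticomplete_to[OF free K that _ P(2)]) blast
  ultimately have "independent_set S" if "S \<in> \<I>" for S
    using that by (auto simp: \<I>_def independent_set_anticomplete_to_edge[OF free(1)])
  moreover have "verts G \<subseteq> \<Union>\<I>"
    using verts_subset_avoiding_pairs_cover[OF K abcd(2) P(1) avoid]
    by (simp add: \<I>_def cls_def Un_assoc)
  moreover have "finite \<I>"
    using finite_clique[OF K(1)] by (simp add: \<I>_def)
  moreover have "card \<I> \<le> clique_number G + 2"
  proof -
    have "card \<I> \<le> card {anticomplete_to {a, b}, anticomplete_to {c, d}} + card (cls ` K)"
      unfolding \<I>_def by (rule card_Un_le)
    also have "\<dots> \<le> 2 + card K"
      using finite_clique[OF K(1)] by (intro add_mono card_image_le) (simp_all add: card_insert_if)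
    finally show ?thesis
      using K(2) by simp
  qed
  ultimately show thesis
    using that by blast
qed

end

theorem theorem2p6:
  fixes G :: "('a, 'b) pre_digraph"
  assumes "graph G"
    and "induced_free {with_proj two_K2, with_proj K2_join_P4} G"
    and "clique_number G \<ge> 4"
  shows "chromatic_number G \<le> clique_number G + 2"
proof -
  interpret graph G by fact
  have "induced_free {with_proj two_K2} G" "induced_free {with_proj K2_join_P4} G"
    using assms(2) by (simp_all add: induced_free_insert[of _ "{_}"])
  then obtain \<I> where "finite \<I>" "\<And>S. S \<in> \<I> \<Longrightarrow> independent_set S" "verts G \<subseteq> \<Union>\<I>"
    and card: "card \<I> \<le> clique_number G + 2"
    using obtain_independent_cover assms(3) by blast
  then have "chromatic_number G \<le> card \<I>"
    by (intro chromatic_number_le_card_independent_cover)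
  also note card
  finally show ?thesis .
qed

end
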